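(* Let $A\in\mathbb{R}^{n\times m}$ with singular value decomposition $A=U\Sigma V^\top$, where $U\in\mathbb{R}^{n\times s}$ and $V\in\mathbb{R}^{m\times s}$ have orthonormal columns and $\Sigma=\operatorname{diag}(\sigma_1,\ldots,\sigma_s)$ with $\sigma_1\ge\cdots\ge\sigma_s\ge0$. Let $u_i,v_j\in\mathbb{R}^s$ be the $i$th row of $U$ and the $j$th row of $V$. Let $I=(i_1,\ldots,i_k)$, $J=(j_1,\ldots,j_k)$ be ordered tuples of row and column indices such that $S=A(I,J)$ is nonsingular. Suppose $k\le M\le s$, $\sigma_{M+1}=0$, and, for some $\ell\in[n]$, $$P_Mu_\ell\in\operatorname{span}\{P_Mu_{i_1},\ldots,P_Mu_{i_k}\}.$$ Then $\big(A-A(:,J)S^{-1}A(I,:)\big)_{\ell p}=0$ for every $p\in[m]$. Analogously, if $k\le M\le s$, $\sigma_{M+1}=0$, and, for some $p\in[m]$, $P_Mv_p\in\operatorname{span}\{P_Mv_{j_1},\ldots,P_Mv_{j_k}\}$, then $\big(A-A(:,J)S^{-1}A(I,:)\big)_{\ell p}=0$ for every $\ell\in[n]$.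
   Context: $P_M:\mathbb{R}^s\to\mathbb{R}^M$ is the projection onto the first $M$ coordinates. Convention $\sigma_{s+1}=0$. $A(:,J)$ and $A(I,:)$ are the selected columns and rows of $A$, and $A(I,J)$ has entries $A_{i_aj_b}$. $[n]=\{1,\ldots,n\}$. *)

theory Defs
  imports
    Complex_Main
    "Jordan_Normal_Form.Matrix"
    "Jordan_Normal_Form.Gauss_Jordan_Elimination"
    "Jordan_Normal_Form.VS_Connect"
begin

text \<open>Rows, columns and vector entries are indexed from 0, as usual for these matrices: the
  index set $[n]$ becomes \<open>{..<n}\<close>, and $\sigma_{j}$ becomes entry $j-1$ of the vector \<open>\<sigma>\<close>.\<close>

definition orthonormal_cols :: "real mat \<Rightarrow> bool" where
  "orthonormal_cols U \<longleftrightarrow>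
     (\<forall>i < dim_col U. \<forall>j < dim_col U. col U i \<bullet> col U j = (if i = j then 1 else 0))"

text \<open>A thin singular value decomposition \<open>A = U \<Sigma> V\<^sup>T\<close> with \<open>\<Sigma> = diag(\<sigma>)\<close> of size \<open>dim_vec \<sigma>\<close>,
  for \<open>A\<close> of any shape; the number of singular values is not required to be minimal, so zero
  singular values may occur.\<close>
definition is_svd :: "real mat \<Rightarrow> real mat \<Rightarrow> real vec \<Rightarrow> real mat \<Rightarrow> bool" where
  "is_svd A U \<sigma> V \<longleftrightarrow>
     (let s = dim_vec \<sigma> in
        U \<in> carrier_mat (dim_row A) s \<and> V \<in> carrier_mat (dim_col A) s \<and>
        orthonormal_cols U \<and> orthonormal_cols V \<and>
        (\<forall>i j. i \<le> j \<and> j < s \<longrightarrow> \<sigma> $ j \<le> \<sigma> $ i) \<and> (\<forall>j < s. 0 \<le> \<sigma> $ j) \<and>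
        A = U * mat_diag s (\<lambda>j. \<sigma> $ j) * transpose_mat V)"

text \<open>The entries of \<open>\<sigma>\<close> extended by zero. With \<open>s = dim_vec \<sigma>\<close>, \<open>sing_val \<sigma> M\<close> is $\sigma_{M+1}$
  for \<open>M \<le> s\<close>, including the convention $\sigma_{s+1} = 0$.\<close>
definition sing_val :: "real vec \<Rightarrow> nat \<Rightarrow> real" where
  "sing_val \<sigma> j = (if j < dim_vec \<sigma> then \<sigma> $ j else 0)"

text \<open>Selections along ordered tuples of indices, which the library's \<open>submatrix\<close> (indexed by
  sets) does not provide.\<close>
definition sel_rows :: "'a mat \<Rightarrow> nat list \<Rightarrow> 'a mat" where
  "sel_rows A I = mat (length I) (dim_col A) (\<lambda>(a, j). A $$ (I ! a, j))"

definition sel_cols :: "'a mat \<Rightarrow> nat list \<Rightarrow> 'a mat" where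
  "sel_cols A J = mat (dim_row A) (length J) (\<lambda>(i, b). A $$ (i, J ! b))"

definition sel_mat :: "'a mat \<Rightarrow> nat list \<Rightarrow> nat list \<Rightarrow> 'a mat" where
  "sel_mat A I J = mat (length I) (length J) (\<lambda>(a, b). A $$ (I ! a, J ! b))"

text \<open>Meaningful only for invertible matrices.\<close>
definition mat_inv :: "'a::field mat \<Rightarrow> 'a mat" where
  "mat_inv S = the (mat_inverse S)"

text \<open>The linear span in $\mathbb{R}^d$ of a set of vectors of dimension \<open>d\<close>.\<close>
abbreviation vec_span :: "nat \<Rightarrow> real vec set \<Rightarrow> real vec set" where
  "vec_span d \<equiv> LinearCombinations.module.span class_ring (module_vec TYPE(real) d)"

text \<open>The projection $P_M$ onto the first \<open>M\<close> coordinates is the library's \<open>vec_first v M\<close>, for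
  vectors \<open>v\<close> of dimension at least \<open>M\<close>.\<close>

end

theory Submission
  imports Defs
begin

text \<open>Let \<open>E = A - A(:,J) S\<inverse> A(I,:)\<close>. A factorisation \<open>A = B C\<close> induces a factorisation \<open>E = B Z\<close>
  with the same left factor, where \<open>Z = C - C(:,J) S\<inverse> A(I,:)\<close>. Take \<open>B = U\<close> and \<open>C = \<Sigma> V\<^sup>T\<close>.
  Since the singular values are nonnegative and decreasing, those after \<open>\<sigma>\<^sub>M\<close> are all zero, so the
  corresponding rows of \<open>C\<close>, and hence those of \<open>Z\<close>, vanish. Therefore the entry of \<open>E\<close> at
  \<open>(i, p)\<close> is the inner product of \<open>P\<^sub>M u\<^sub>i\<close> with a vector \<open>z\<^sub>p\<close> that does not depend on \<open>i\<close>. The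
  rows of \<open>E\<close> indexed by \<open>I\<close> are zero, because \<open>A(I,:) = S S\<inverse> A(I,:)\<close>. So \<open>z\<^sub>p\<close> is orthogonal to
  \<open>P\<^sub>M u\<^sub>i\<close> for every \<open>i\<close> in \<open>I\<close>, therefore to their span, therefore to \<open>P\<^sub>M u\<^sub>l\<close>.
  The statement about columns is the statement about rows for \<open>A\<^sup>T = V \<Sigma> U\<^sup>T\<close>, with \<open>I\<close> and \<open>J\<close>
  exchanged.\<close>

lemma sel_rows_carrier [simp]: "A \<in> carrier_mat n m \<Longrightarrow> sel_rows A I \<in> carrier_mat (length I) m"
  by (auto simp: sel_rows_def)

lemma sel_cols_carrier [simp]: "A \<in> carrier_mat n m \<Longrightarrow> sel_cols A J \<in> carrier_mat n (length J)"
  by (auto simp: sel_cols_def)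

lemma sel_mat_carrier [simp]: "sel_mat A I J \<in> carrier_mat (length I) (length J)"
  by (auto simp: sel_mat_def)

lemma dim_sel [simp]:
  "dim_row (sel_rows A I) = length I" "dim_col (sel_rows A I) = dim_col A"
  "dim_row (sel_cols A J) = dim_row A" "dim_col (sel_cols A J) = length J"
  by (simp_all add: sel_rows_def sel_cols_def)

lemma nth_less_bound: "set I \<subseteq> {..<n} \<Longrightarrow> a < length I \<Longrightarrow> I ! a < n"
  using nth_mem by blast

lemma transpose_sel_rows:
  assumes "A \<in> carrier_mat n m" "set I \<subseteq> {..<n}"
  shows "transpose_mat (sel_rows A I) = sel_cols (transpose_mat A) I"
  using assms by (intro eq_matI) (auto simp: sel_rows_def sel_cols_def nth_less_bound)

lemma transpose_sel_cols:
  assumes "A \<in> carrier_mat n m" "set J \<subseteq> {..<m}"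
  shows "transpose_mat (sel_cols A J) = sel_rows (transpose_mat A) J"
  using assms by (intro eq_matI) (auto simp: sel_rows_def sel_cols_def nth_less_bound)

lemma transpose_sel_mat:
  assumes "A \<in> carrier_mat n m" "set I \<subseteq> {..<n}" "set J \<subseteq> {..<m}"
  shows "transpose_mat (sel_mat A I J) = sel_mat (transpose_mat A) J I"
  using assms by (intro eq_matI) (auto simp: sel_mat_def nth_less_bound)

lemma sel_cols_mult:
  fixes B C :: "'a::semiring_0 mat"
  assumes "B \<in> carrier_mat n s" "C \<in> carrier_mat s m" "set J \<subseteq> {..<m}"
  shows "sel_cols (B * C) J = B * sel_cols C J"
proof (rule eq_matI)
  fix i b assume *: "i < dim_row (B * sel_cols C J)" "b < dim_col (B * sel_cols C J)"
  then have "J ! b < m" "b < length J"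
    using assms by (auto simp: sel_cols_def nth_less_bound)
  moreover from this have "col (sel_cols C J) b = col C (J ! b)"
    using assms by (intro eq_vecI) (simp_all add: sel_cols_def)
  ultimately show "sel_cols (B * C) J $$ (i, b) = (B * sel_cols C J) $$ (i, b)"
    using assms * by (simp add: sel_cols_def)
qed (use assms in \<open>simp_all add: sel_cols_def\<close>)

lemma inverts_mat_mat_inv:
  fixes S :: "'a::field mat"
  assumes S: "S \<in> carrier_mat k k" and inv: "invertible_mat S"
  shows "mat_inv S \<in> carrier_mat k k" "S * mat_inv S = 1\<^sub>m k" "mat_inv S * S = 1\<^sub>m k"
proof -
  obtain T where T: "S * T = 1\<^sub>m (dim_row S)" "T * S = 1\<^sub>m (dim_row T)"
    using inv by (auto simp: invertible_mat_def inverts_mat_def)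
  have "dim_col T = k" "dim_row T = k"
    using S arg_cong[OF T(1), of dim_col] arg_cong[OF T(2), of dim_col] by auto
  then have "T \<in> carrier_mat k k" by auto
  then have "S \<in> Units (ring_mat TYPE('a) k ())"
    using T S by (auto simp: Units_def ring_mat_def)
  then obtain T' where T': "mat_inverse S = Some T'"
    using mat_inverse(1)[OF S, of "()"] by (cases "mat_inverse S") auto
  show "mat_inv S \<in> carrier_mat k k" "S * mat_inv S = 1\<^sub>m k" "mat_inv S * S = 1\<^sub>m k"
    using mat_inverse(2)[OF S T'] T' by (auto simp: mat_inv_def)
qed

lemma vec_span_orthogonal:
  assumes z: "z \<in> carrier_vec d" and G: "G \<subseteq> carrier_vec d"
    and orth: "\<And>g. g \<in> G \<Longrightarrow> g \<bullet> z = 0" and w: "w \<in> vec_span d G"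
  shows "w \<bullet> z = 0"
proof -
  interpret vec_space "TYPE(real)" d .
  obtain a F where F: "finite F" "F \<subseteq> G" and w_eq: "w = lincomb a F"
    using w by (auto simp: span_def)
  have FC: "F \<subseteq> carrier_vec d" using F G by auto
  have "lincomb a F \<bullet> z = (\<Sum>v\<in>F. a v * (v \<bullet> z))"
    using F(1) FC
  proof (induction F rule: finite_induct)
    case empty
    show ?case using z by simp
  next
    case (insert x F)
    then have "lincomb a (insert x F) = a x \<cdot>\<^sub>v x + lincomb a F"
      by (subst lincomb_insert2) auto
    moreover have "lincomb a F \<in> carrier_vec d"
      using insert by (intro lincomb_closed) auto
    ultimately show ?case
      using insert z by (simp add: add_scalar_prod_distrib[of _ d])
  qed
  also have "\<dots> = 0" using orth F by (intro sum.neutral) auto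
  finally show ?thesis by (simp add: w_eq)
qed

lemma scalar_prod_vec_first:
  fixes v w :: "'a::semiring_0 vec"
  assumes "v \<in> carrier_vec s" "w \<in> carrier_vec s" "M \<le> s"
    and "\<And>j. M \<le> j \<Longrightarrow> j < s \<Longrightarrow> w $ j = 0"
  shows "v \<bullet> w = vec_first v M \<bullet> vec_first w M"
proof -
  have "v \<bullet> w = (\<Sum>j\<in>{0..<s}. v $ j * w $ j)"
    using assms by (simp add: scalar_prod_def)
  also have "\<dots> = (\<Sum>j\<in>{0..<M}. v $ j * w $ j)"
    using assms by (intro sum.mono_neutral_right) auto
  also have "\<dots> = vec_first v M \<bullet> vec_first w M"
    by (simp add: scalar_prod_def vec_first_def)
  finally show ?thesis .
qed

text \<open>The approximation \<open>A(:,J) T A(I,:)\<close> interpolates \<open>A\<close> on the rows in \<open>I\<close>: the selected rows of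
  \<open>A(:,J) T\<close> are those of \<open>A(I,J) T\<close>, which is the identity.\<close>

lemma cross_approximation_sel_row:
  fixes A T :: "'a::comm_ring_1 mat"
  assumes A: "A \<in> carrier_mat n m" and I: "set I \<subseteq> {..<n}"
    and T: "T \<in> carrier_mat (length J) (length I)" "sel_mat A I J * T = 1\<^sub>m (length I)"
    and i: "i \<in> set I" and p: "p < m"
  shows "(A - sel_cols A J * T * sel_rows A I) $$ (i, p) = 0"
proof -
  obtain a where a: "a < length I" "i = I ! a" using i by (auto simp: in_set_conv_nth)
  have i': "i < n" using i I by auto
  have row: "row (sel_cols A J) i = row (sel_mat A I J) a"
    using a A i' by (intro eq_vecI) (simp_all add: sel_cols_def sel_mat_def)
  have "row (sel_cols A J * T) i = row (sel_mat A I J * T) a"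
    using a A i' T(1) row by (intro eq_vecI) (simp_all add: sel_cols_def sel_mat_def)
  then have "row (sel_cols A J * T) i = row (1\<^sub>m (length I)) a"
    by (simp add: T(2))
  then have "(sel_cols A J * T * sel_rows A I) $$ (i, p) = (1\<^sub>m (length I) * sel_rows A I) $$ (a, p)"
    using a A i' p T(1) by (simp add: sel_cols_def sel_rows_def)
  also have "\<dots> = A $$ (i, p)"
    using a A p by (subst left_mult_one_mat) (auto simp: sel_rows_def)
  finally show ?thesis
    using A T(1) i' p by simp
qed

text \<open>The row version for an arbitrary factorisation \<open>A = B C\<close> in which only the first \<open>M\<close> rows of
  \<open>C\<close> can be nonzero. It is applied both to \<open>A = U (\<Sigma> V\<^sup>T)\<close> and to \<open>A\<^sup>T = V (\<Sigma> U\<^sup>T)\<close>.\<close>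

lemma cross_approximation_exact_row:
  fixes A B C T :: "real mat"
  assumes B: "B \<in> carrier_mat n s" and C: "C \<in> carrier_mat s m" and A: "A = B * C"
    and I: "set I \<subseteq> {..<n}" and J: "set J \<subseteq> {..<m}"
    and T: "T \<in> carrier_mat (length J) (length I)" "sel_mat A I J * T = 1\<^sub>m (length I)"
    and M: "M \<le> s" and C0: "\<And>j q. M \<le> j \<Longrightarrow> j < s \<Longrightarrow> q < m \<Longrightarrow> C $$ (j, q) = 0"
    and l: "l < n"
    and sp: "vec_first (row B l) M \<in> vec_span M ((\<lambda>i. vec_first (row B i) M) ` set I)"
    and p: "p < m"
  shows "(A - sel_cols A J * T * sel_rows A I) $$ (l, p) = 0"
proof -
  have Ac: "A \<in> carrier_mat n m" using A B C by simp
  \<comment> \<open>\<open>Z\<close> is the residual of \<open>C\<close>, so that the residual of \<open>A\<close> is \<open>B * Z\<close>.\<close>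
  define R where "R = T * sel_rows A I"
  define Z where "Z = C - sel_cols C J * R"
  have R: "R \<in> carrier_mat (length J) m" using T(1) Ac by (auto simp: R_def)
  have Z: "Z \<in> carrier_mat s m"
    using C R by (auto simp: Z_def intro!: minus_carrier_mat mult_carrier_mat)
  have "sel_cols A J * T * sel_rows A I = B * sel_cols C J * R"
    using assoc_mult_mat[OF sel_cols_carrier[OF Ac, of J] T(1) sel_rows_carrier[OF Ac, of I]]
    by (simp add: A R_def sel_cols_mult[OF B C J])
  also have "\<dots> = B * (sel_cols C J * R)"
    by (rule assoc_mult_mat[OF B sel_cols_carrier[OF C] R])
  finally have EZ: "A - sel_cols A J * T * sel_rows A I = B * Z"
    using mult_minus_distrib_mat[OF B C mult_carrier_mat[OF sel_cols_carrier[OF C, of J] R]]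
    by (simp add: Z_def A)
  have Z0: "Z $$ (j, p) = 0" if j: "M \<le> j" "j < s" for j
  proof -
    have "J ! b < m" if "b < length J" for b using that J by (rule nth_less_bound[rotated])
    then have "row (sel_cols C J) j = 0\<^sub>v (length J)"
      using C C0 j by (intro eq_vecI) (auto simp: sel_cols_def)
    moreover have "col R p \<in> carrier_vec (length J)"
      using R by (intro carrier_vecI) simp
    ultimately show ?thesis
      using R C C0 j p by (simp add: Z_def sel_cols_def)
  qed
  have E: "(A - sel_cols A J * T * sel_rows A I) $$ (i, p)
      = vec_first (row B i) M \<bullet> vec_first (col Z p) M" if "i < n" for i
  proof -
    have "(B * Z) $$ (i, p) = row B i \<bullet> col Z p" using B Z p that by simp
    also have "\<dots> = vec_first (row B i) M \<bullet> vec_first (col Z p) M"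
      using B Z p M Z0 that by (intro scalar_prod_vec_first[of _ s]) auto
    finally show ?thesis by (simp add: EZ)
  qed
  have "vec_first (row B l) M \<bullet> vec_first (col Z p) M = 0"
  proof (rule vec_span_orthogonal[OF _ _ _ sp])
    fix g assume "g \<in> (\<lambda>i. vec_first (row B i) M) ` set I"
    then obtain i where i: "i \<in> set I" "g = vec_first (row B i) M" by auto
    then have "i < n" using I by auto
    then show "g \<bullet> vec_first (col Z p) M = 0"
      using E[of i] i cross_approximation_sel_row[OF Ac I T i(1) p] by simp
  qed auto
  then show ?thesis using E[OF l] by simp
qed

theorem corollary2p7:
  fixes A U V S :: "real mat" and \<sigma> :: "real vec" and I J :: "nat list" and n m s k :: nat
  assumes A: "A \<in> carrier_mat n m"
    and s: "dim_vec \<sigma> = s"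
    and svd: "is_svd A U \<sigma> V"
    and I: "length I = k" "set I \<subseteq> {..<n}"
    and J: "length J = k" "set J \<subseteq> {..<m}"
    and S: "S = sel_mat A I J" "invertible_mat S"
  shows
    "(\<forall>M l. k \<le> M \<and> M \<le> s \<and> sing_val \<sigma> M = 0 \<and> l < n \<and>
        vec_first (row U l) M \<in> vec_span M ((\<lambda>i. vec_first (row U i) M) ` set I) \<longrightarrow>
        (\<forall>p < m. (A - sel_cols A J * mat_inv S * sel_rows A I) $$ (l, p) = 0)) \<and>
     (\<forall>M p. k \<le> M \<and> M \<le> s \<and> sing_val \<sigma> M = 0 \<and> p < m \<and>
        vec_first (row V p) M \<in> vec_span M ((\<lambda>j. vec_first (row V j) M) ` set J) \<longrightarrow>
        (\<forall>l < n. (A - sel_cols A J * mat_inv S * sel_rows A I) $$ (l, p) = 0))"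
proof -
  define D where "D = mat_diag s (\<lambda>j. \<sigma> $ j)"
  have D: "D \<in> carrier_mat s s" "transpose_mat D = D"
    by (auto simp: D_def mat_diag_def)
  have U: "U \<in> carrier_mat n s" and V: "V \<in> carrier_mat m s"
    and A_eq: "A = U * D * transpose_mat V"
    and ord: "\<And>i j. i \<le> j \<Longrightarrow> j < s \<Longrightarrow> \<sigma> $ j \<le> \<sigma> $ i"
    and nonneg: "\<And>j. j < s \<Longrightarrow> 0 \<le> \<sigma> $ j"
    using svd A s by (auto simp: is_svd_def Let_def D_def)
  have Vt: "transpose_mat V \<in> carrier_mat s m" and Ut: "transpose_mat U \<in> carrier_mat s n"
    using U V by auto
  have A1: "A = U * (D * transpose_mat V)"
    using A_eq assoc_mult_mat[OF U D(1) Vt] by simp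
  have A2: "transpose_mat A = V * (D * transpose_mat U)"
  proof -
    have "transpose_mat A = transpose_mat (D * transpose_mat V) * transpose_mat U"
      unfolding A1 by (rule transpose_mult[OF U]) (use D Vt in auto)
    also have "transpose_mat (D * transpose_mat V) = V * D"
      using transpose_mult[OF D(1) Vt] D by simp
    finally show ?thesis using assoc_mult_mat[OF V D(1) Ut] by simp
  qed
  have sig0: "\<sigma> $ j = 0" if "sing_val \<sigma> M = 0" "M \<le> j" "j < s" for M j
    using that ord[of M j] nonneg[of j] s by (auto simp: sing_val_def)
  have D0: "(D * X) $$ (j, q) = 0"
    if "sing_val \<sigma> M = 0" "M \<le> j" "j < s" "q < r" "X \<in> carrier_mat s r" for M j q r X
    using that sig0[OF that(1-3)] by (simp add: D_def mat_diag_mult_left[of _ s r])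
  have Sc: "S \<in> carrier_mat k k" using S I J by (metis sel_mat_carrier)
  note T = inverts_mat_mat_inv[OF Sc S(2)]
  let ?E = "A - sel_cols A J * mat_inv S * sel_rows A I"
  have part1: "?E $$ (l, p) = 0"
    if "M \<le> s" "sing_val \<sigma> M = 0" "l < n" "p < m"
      "vec_first (row U l) M \<in> vec_span M ((\<lambda>i. vec_first (row U i) M) ` set I)" for M l p
    by (rule cross_approximation_exact_row[OF U mult_carrier_mat[OF D(1) Vt] A1 I(2) J(2) _ _
          that(1) D0[OF that(2) _ _ _ Vt] that(3,5,4)])
      (use T S(1) I(1) J(1) in simp_all)
  \<comment> \<open>Transposing exchanges the roles of \<open>(U, I)\<close> and \<open>(V, J)\<close>, and a left inverse of \<open>S\<close>
    becomes a right inverse of \<open>A\<^sup>T(J,I) = S\<^sup>T\<close>.\<close>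
  let ?Et = "transpose_mat A - sel_cols (transpose_mat A) I * transpose_mat (mat_inv S)
      * sel_rows (transpose_mat A) J"
  have Et: "?Et = transpose_mat ?E"
  proof -
    have cJ: "sel_cols A J \<in> carrier_mat n k" and rI: "sel_rows A I \<in> carrier_mat k m"
      using sel_cols_carrier[OF A, of J] sel_rows_carrier[OF A, of I] I(1) J(1) by simp_all
    have "transpose_mat (sel_cols A J * mat_inv S * sel_rows A I)
        = sel_cols (transpose_mat A) I * (transpose_mat (mat_inv S) * sel_rows (transpose_mat A) J)"
      using transpose_mult[OF mult_carrier_mat[OF cJ T(1)] rI] transpose_mult[OF cJ T(1)]
      by (simp add: transpose_sel_rows[OF A I(2)] transpose_sel_cols[OF A J(2)])
    also have "\<dots> = sel_cols (transpose_mat A) I * transpose_mat (mat_inv S)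
        * sel_rows (transpose_mat A) J"
      using A I J T by (intro assoc_mult_mat[symmetric, of _ m k _ k _ n]) auto
    finally show ?thesis
      using transpose_minus[OF A mult_carrier_mat[OF mult_carrier_mat[OF cJ T(1)] rI]] by simp
  qed
  have "sel_mat (transpose_mat A) J I * transpose_mat (mat_inv S) = transpose_mat (mat_inv S * S)"
    using transpose_mult[OF T(1) Sc] transpose_sel_mat[OF A I(2) J(2)] S(1) by simp
  then have Tt: "sel_mat (transpose_mat A) J I * transpose_mat (mat_inv S) = 1\<^sub>m k"
    using T(3) by simp
  have part2: "?E $$ (l, p) = 0"
    if "M \<le> s" "sing_val \<sigma> M = 0" "l < n" "p < m"
      "vec_first (row V p) M \<in> vec_span M ((\<lambda>j. vec_first (row V j) M) ` set J)" for M l p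
  proof -
    have "?Et $$ (p, l) = 0"
      by (rule cross_approximation_exact_row[OF V mult_carrier_mat[OF D(1) Ut] A2 J(2) I(2) _ _
            that(1) D0[OF that(2) _ _ _ Ut] that(4,5,3)])
        (use T Tt I(1) J(1) in simp_all)
    then show ?thesis unfolding Et using that A T by simp
  qed
  show ?thesis using part1 part2 by meson
qed

end
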